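(* Let $n\ge 2$ be an integer. Let $M_n=\{(n-k,1^k):0\le k\le n-1\}$ be the main chain, $L_n=\{(n-k,k):1\le k\le\lfloor n/2\rfloor\}$ the left edge, and $R_n=\{\lambda':\lambda\in L_n\}$ the right edge of the partition graph $G_n$. Then $L_n$ and $R_n$ form paths in $G_n$: for each $1\le k<\lfloor n/2\rfloor$, the vertices $(n-k,k)$ and $(n-k-1,k+1)$ are adjacent in $G_n$, and so are their conjugates. Moreover, $L_n$ meets $M_n$ at $(n-1,1)$, i.e. $L_n\cap M_n=\{(n-1,1)\}$, and $R_n$ meets $M_n$ at $(2,1^{n-2})$, i.e. $R_n\cap M_n=\{(2,1^{n-2})\}$.
   Context: A partition of a positive integer $n$ is a finite weakly decreasing sequence $\lambda=(\lambda_1,\dots,\lambda_\ell)$ of positive integers with sum $n$ (written $\lambda\vdash n$); partitions are identified with their Ferrers diagrams. Exponents denote repeated parts, e.g. $(n-k,1^k)$ has first part $n-k$ followed by $k$ parts equal to $1$. The conjugate $\lambda'$ of $\lambda$ is the partition obtained by interchanging rows and columns of the Ferrers diagram. The partition graph $G_n$ is the simple graph whose vertices are the partitions of $n$; two distinct partitions are adjacent if and only if one is obtained from the other by an elementary transfer of one cell of the Ferrers diagram (moving a cell from a removable corner to an addable corner, followed by reordering, with the result different from the original partition). Equivalently: one decreases one part by $1$ and increases another part by $1$, where the increased part may also be a new part of length $0$ (thus creating a new part $1$), deletes any part that became $0$, sorts into weakly decreasing order, and requires that the resulting partition differ from the original. A path may consist of a single vertex. *)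

theory Defs
  imports "Graph_Theory.Graph_Theory"
begin

text \<open>A partition is the weakly decreasing list of its (positive) parts.\<close>

definition is_partition :: "nat list \<Rightarrow> bool" where
  "is_partition p \<longleftrightarrow> sorted_wrt (\<ge>) p \<and> (\<forall>x\<in>set p. 0 < x)"

definition partitions :: "nat \<Rightarrow> nat list set" where
  "partitions n = {p. is_partition p \<and> sum_list p = n}"

definition ferrers :: "nat list \<Rightarrow> (nat \<times> nat) set" where
  "ferrers p = {(i, j). i < length p \<and> j < p ! i}"

text \<open>The \<open>j\<close>-th part of the conjugate is the length of the \<open>j\<close>-th column of the diagram; the
  number of columns is the length of the top row. The lemmas \<open>conjugate_partition\<close> and
  \<open>ferrers_conjugate\<close> below confirm that this transposes the diagram.\<close>

definition conjugate :: "nat list \<Rightarrow> nat list" where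
  "conjugate p = map (\<lambda>j. card {i. (i, j) \<in> ferrers p}) [0..<card {j. (0, j) \<in> ferrers p}]"

text \<open>The new part of length 0 is modelled by \<open>p @ [0]\<close>: the decreased part \<open>i\<close> is a part of \<open>p\<close>,
  the increased part \<open>j\<close> may be the appended one.\<close>

definition transfer_result :: "nat list \<Rightarrow> nat \<Rightarrow> nat \<Rightarrow> nat list" where
  "transfer_result p i j =
     rev (sort (filter (\<lambda>x. 0 < x) ((p @ [0])[i := p ! i - 1, j := (p @ [0]) ! j + 1])))"

definition elementary_transfer :: "nat list \<Rightarrow> nat list \<Rightarrow> bool" where
  "elementary_transfer p q \<longleftrightarrow>
     (\<exists>i j. i < length p \<and> j \<le> length p \<and> i \<noteq> j \<and> q = transfer_result p i j) \<and> q \<noteq> p"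

text \<open>A simple graph is a symmetric loop-free digraph; see \<open>pair_graph_partition_graph\<close> below.\<close>

definition partition_graph :: "nat \<Rightarrow> nat list pair_pre_digraph" where
  "partition_graph n =
     \<lparr> pverts = partitions n,
       parcs = {(p, q). p \<in> partitions n \<and> q \<in> partitions n \<and>
                        (elementary_transfer p q \<or> elementary_transfer q p)} \<rparr>"

definition main_chain :: "nat \<Rightarrow> nat list set" where
  "main_chain n = {(n - k) # replicate k 1 | k. k \<le> n - 1}"

definition left_edge :: "nat \<Rightarrow> nat list set" where
  "left_edge n = {[n - k, k] | k. 1 \<le> k \<and> k \<le> n div 2}"

definition right_edge :: "nat \<Rightarrow> nat list set" where
  "right_edge n = conjugate ` left_edge n"

definition left_path :: "nat \<Rightarrow> nat list list" where
  "left_path n = map (\<lambda>k. [n - k, k]) [1..<Suc (n div 2)]"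

definition right_path :: "nat \<Rightarrow> nat list list" where
  "right_path n = map conjugate (left_path n)"

lemma finite_partitions: "finite (partitions n)"
proof (rule finite_subset)
  have len: "length p \<le> sum_list p" if "\<forall>x\<in>set p. 0 < x" for p :: "nat list"
    using that by (induction p) auto
  show "partitions n \<subseteq> {p. set p \<subseteq> {..n} \<and> length p \<le> n}"
    using len by (auto simp: partitions_def is_partition_def intro: member_le_sum_list)
  show "finite {p. set p \<subseteq> {..n} \<and> length p \<le> n}"
    by (rule finite_lists_length_le) simp
qed

lemma pair_graph_partition_graph: "pair_graph (partition_graph n)"
proof -
  have "parcs (partition_graph n) \<subseteq> partitions n \<times> partitions n"
    by (auto simp: partition_graph_def)
  hence fin: "finite (parcs (partition_graph n))"
    by (rule finite_subset) (simp add: finite_partitions)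
  have "arcs_ends (with_proj (partition_graph n)) = parcs (partition_graph n)"
    by (simp add: arcs_ends_def arc_to_ends_def)
  thus ?thesis
    by unfold_locales
      (use fin in \<open>auto simp: partition_graph_def finite_partitions elementary_transfer_def
        symmetric_def intro!: symI\<close>)
qed

lemma ferrers_row: "{j. (i, j) \<in> ferrers p} = {..<if i < length p then p ! i else 0}"
  by (auto simp: ferrers_def)

lemma ferrers_column:
  assumes "is_partition p"
  shows "{i. (i, j) \<in> ferrers p} = {..<card {i. (i, j) \<in> ferrers p}}"
proof -
  let ?C = "{i. (i, j) \<in> ferrers p}"
  have fin: "finite ?C"
    by (rule finite_subset[of _ "{..<length p}"]) (auto simp: ferrers_def)
  have down: "i' \<in> ?C" if "i \<in> ?C" "i' \<le> i" for i i'
  proof (cases "i' = i")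
    case False
    with that assms have "p ! i \<le> p ! i'"
      by (auto simp: is_partition_def ferrers_def sorted_wrt_iff_nth_less)
    with that show ?thesis by (auto simp: ferrers_def)
  qed (use that in simp)
  show ?thesis
  proof (cases "?C = {}")
    case False
    have "?C = {..<Suc (Max ?C)}"
    proof (intro equalityI subsetI)
      fix i assume "i \<in> ?C"
      thus "i \<in> {..<Suc (Max ?C)}" using Max_ge[OF fin] by (simp add: less_Suc_eq_le)
    next
      fix i assume "i \<in> {..<Suc (Max ?C)}"
      thus "i \<in> ?C" using down[OF Max_in[OF fin False]] by (simp only: lessThan_iff less_Suc_eq_le)
    qed
    then obtain m where m: "?C = {..<m}" by blast
    show ?thesis unfolding m by simp
  next
    case True
    show ?thesis unfolding True by simp
  qed
qed

lemma ferrers_conjugate: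
  assumes "is_partition p"
  shows "ferrers (conjugate p) = (ferrers p)\<inverse>"
proof -
  have col: "i < card {i. (i, j) \<in> ferrers p} \<longleftrightarrow> (i, j) \<in> ferrers p" for i j
    using ferrers_column[OF assms, of j] by blast
  have top: "(0, j) \<in> ferrers p" if "(i, j) \<in> ferrers p" for i j
    using col[of 0 j] col[of i j] that by linarith
  have row: "j < card {j. (0, j) \<in> ferrers p} \<longleftrightarrow> (0, j) \<in> ferrers p" for j
    unfolding ferrers_row by (simp add: ferrers_def)
  have "(j, i) \<in> ferrers (conjugate p) \<longleftrightarrow> (i, j) \<in> ferrers p" for i j
  proof -
    have "(j, i) \<in> ferrers (conjugate p) \<longleftrightarrow>
        j < card {j. (0, j) \<in> ferrers p} \<and> i < card {i. (i, j) \<in> ferrers p}"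
      unfolding ferrers_def[of "conjugate p"] by (auto simp: conjugate_def)
    with row col top show ?thesis by blast
  qed
  thus ?thesis by auto
qed

lemma card_ferrers: "card (ferrers p) = sum_list p"
proof -
  have "ferrers p = Sigma {..<length p} (\<lambda>i. {..<p ! i})"
    by (auto simp: ferrers_def)
  thus ?thesis by (simp add: sum_list_sum_nth atLeast0LessThan)
qed

lemma conjugate_partition:
  assumes "p \<in> partitions n"
  shows "conjugate p \<in> partitions n"
proof -
  have p: "is_partition p" "sum_list p = n"
    using assms by (auto simp: partitions_def)
  have fin: "finite {i. (i, j) \<in> ferrers p}" for j
    by (rule finite_subset[of _ "{..<length p}"]) (auto simp: ferrers_def)
  have "card {i. (i, j') \<in> ferrers p} \<le> card {i. (i, j) \<in> ferrers p}" if "j < j'" for j j'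
    using that by (intro card_mono fin) (auto simp: ferrers_def)
  hence "sorted_wrt (\<ge>) (conjugate p)"
    by (auto simp: conjugate_def sorted_wrt_iff_nth_less)
  moreover have "0 < x" if "x \<in> set (conjugate p)" for x
  proof -
    from that obtain j where j: "j < card {j. (0, j) \<in> ferrers p}"
      and x: "x = card {i. (i, j) \<in> ferrers p}"
      by (auto simp: conjugate_def)
    from j have "(0, j) \<in> ferrers p"
      unfolding ferrers_row by (simp add: ferrers_def split: if_splits)
    thus ?thesis using fin x by (auto simp: card_gt_0_iff)
  qed
  moreover have "sum_list (conjugate p) = n"
    using p by (simp add: card_ferrers[symmetric] ferrers_conjugate card_inverse)
  ultimately show ?thesis
    by (simp add: partitions_def is_partition_def)
qed

end

theory Submission
  imports Defs
begin

text \<open>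
  Both edges consist of explicit lists: a left-edge vertex is a two-row partition
  \<open>[n - k, k]\<close>, and its conjugate has two columns, that is, it consists of \<open>k\<close> twos followed by
  \<open>n - 2 * k\<close> ones (\<open>conjugate_two_rows\<close>). Increasing \<open>k\<close> by one moves the last cell of the first row
  to the end of the second row (\<open>two_rows_adjacent\<close>); on the conjugate side it moves the last cell of
  the first column to the foot of the second, which in terms of parts deletes the last 1 and turns
  the first 1 into a 2 (\<open>two_columns_adjacent\<close>). For \<open>k < n div 2\<close> we have \<open>n - 2 * k \<ge> 2\<close>, so the
  moved cell ends up at an addable corner, and the two ones involved are different parts. The vertices
  are pairwise distinct because \<open>k\<close> can be read off from the second row (respectively from the number
  \<open>n - k\<close> of parts), so the walks are paths.

  All parts of a hook beyond the first equal 1. Hence a two-row partition is a hook exactly when its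
  second row has length 1, and a two-column partition is a hook exactly when it has just one 2;
  both say \<open>k = 1\<close>.
\<close>

section \<open>Paths and transfers\<close>

lemma vpath_map_upt:
  fixes f :: "nat \<Rightarrow> 'a"
  assumes "a < b"
    and verts: "\<And>k. a \<le> k \<Longrightarrow> k < b \<Longrightarrow> f k \<in> verts G"
    and arcs: "\<And>k. a \<le> k \<Longrightarrow> Suc k < b \<Longrightarrow> f k \<rightarrow>\<^bsub>G\<^esub> f (Suc k)"
    and inj: "inj_on f {a..<b}"
  shows "vpath (map f [a..<b]) G"
proof (rule vpathI)
  have "a \<le> b - 1" using \<open>a < b\<close> by simp
  thus "vwalk (map f [a..<b]) G"
    using verts arcs
  proof (induction rule: inc_induct)
    case base
    have "[b - 1..<b] = [b - 1]"
      using \<open>a < b\<close> upt_rec[of "b - 1" b] by simp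
    thus ?case using base.prems(1)[of "b - 1"] \<open>a < b\<close> by (auto simp: vwalk_def)
  next
    case (step m)
    have m: "Suc m < b" using step.hyps by simp
    have "vwalk (f m # map f [Suc m..<b]) G"
    proof (rule vwalk_consI)
      show "vwalk (map f [Suc m..<b]) G"
        using step.IH step.prems by simp
      show "f m \<in> verts G" using step.prems(1) m by simp
      show "f m \<rightarrow>\<^bsub>G\<^esub> hd (map f [Suc m..<b])"
        using step.prems(2)[of m] m by (simp add: hd_map)
    qed
    thus ?case using m by (simp add: upt_conv_Cons)
  qed
  show "distinct (map f [a..<b])" using inj by (simp add: distinct_map)
qed

text \<open>If removing the empty parts already leaves a partition, then the sorting step of a transfer has
  no effect, so adjacency can be read off from the updated list of parts.\<close>

lemma adjacent_by_transfer:
  assumes "p \<in> partitions n" "q \<in> partitions n" "q \<noteq> p"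
    and "i < length p" "j \<le> length p" "i \<noteq> j"
    and q: "filter (\<lambda>x. 0 < x) ((p @ [0])[i := p ! i - 1, j := (p @ [0]) ! j + 1]) = q"
  shows "p \<rightarrow>\<^bsub>with_proj (partition_graph n)\<^esub> q"
proof -
  have "sorted (rev q)"
    using \<open>q \<in> partitions n\<close> by (simp add: partitions_def is_partition_def sorted_wrt_rev)
  hence "sort q = rev q" by (intro properties_for_sort) simp_all
  hence "transfer_result p i j = q" unfolding transfer_result_def q by simp
  hence "elementary_transfer p q"
    using assms by (auto simp: elementary_transfer_def)
  thus ?thesis
    using assms by (simp add: partition_graph_def arcs_ends_def arc_to_ends_def)
qed

section \<open>Two-row partitions\<close>

lemma two_rows_partition:
  assumes "1 \<le> k" "k \<le> n div 2"
  shows "[n - k, k] \<in> partitions n"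
  using assms by (auto simp: partitions_def is_partition_def)

lemma two_rows_adjacent:
  assumes "1 \<le> k" "k < n div 2"
  shows "[n - k, k] \<rightarrow>\<^bsub>with_proj (partition_graph n)\<^esub> [n - k - 1, k + 1]"
proof (rule adjacent_by_transfer[where i = 0 and j = 1])
  show "[n - k - 1, k + 1] \<in> partitions n"
    using two_rows_partition[of "k + 1" n] assms by simp
qed (use assms two_rows_partition[of k n] in auto)

section \<open>Two-column partitions\<close>

abbreviation two_columns :: "nat \<Rightarrow> nat \<Rightarrow> nat list" where
  "two_columns n k \<equiv> replicate k 2 @ replicate (n - 2 * k) 1"

lemma conjugate_two_rows:
  assumes "k \<le> n div 2"
  shows "conjugate [n - k, k] = two_columns n k"
proof -
  have "k \<le> n - k" using assms by simp
  have column: "{i. (i, j) \<in> ferrers [n - k, k]} = (if j < k then {0, 1} else {0})"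
    if "j < n - k" for j
    using that \<open>k \<le> n - k\<close> by (auto simp: ferrers_def less_Suc_eq)
  have "conjugate [n - k, k] = map (\<lambda>j. if j < k then 2 else 1) [0..<n - k]"
    unfolding conjugate_def ferrers_row by (auto simp: column)
  also have "\<dots> = two_columns n k"
    using assms by (intro nth_equalityI) (auto simp: nth_append)
  finally show ?thesis .
qed

lemma two_columns_partition:
  assumes "k \<le> n div 2"
  shows "two_columns n k \<in> partitions n"
  using assms
  by (auto simp: partitions_def is_partition_def sum_list_replicate nth_append
      sorted_wrt_iff_nth_less)

lemma two_columns_adjacent:
  assumes "k < n div 2"
  shows "two_columns n k \<rightarrow>\<^bsub>with_proj (partition_graph n)\<^esub> two_columns n (k + 1)"
proof -
  define m where "m = n - 2 * k - 2"
  have n: "n = 2 * k + m + 2" using assms by (simp add: m_def)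
  \<comment> \<open>The two ones taking part in the transfer are made explicit; they stand at the positions
    \<open>k\<close> and \<open>k + m + 1\<close>.\<close>
  have p: "two_columns n k = replicate k 2 @ 1 # replicate m 1 @ [1]"
    by (simp add: n replicate_append_same)
  have q: "two_columns n (k + 1) = replicate k 2 @ 2 # replicate m 1"
    by (simp add: n replicate_app_Cons_same)
  show ?thesis
  proof (rule adjacent_by_transfer[where i = "k + m + 1" and j = k])
    show "two_columns n k \<in> partitions n" "two_columns n (k + 1) \<in> partitions n"
      by (rule two_columns_partition; use assms in simp)+
  qed (unfold p q, simp_all add: list_update_append nth_append)
qed

section \<open>Intersections with the main chain\<close>

lemma left_edge_Int_main_chain:
  assumes "n \<ge> 2"
  shows "left_edge n \<inter> main_chain n = {[n - 1, 1]}"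
proof (intro equalityI subsetI)
  fix p assume "p \<in> left_edge n \<inter> main_chain n"
  then obtain k j where "p = [n - k, k]" and "p = (n - j) # replicate j 1"
    unfolding left_edge_def main_chain_def by blast
  hence "p = [n - k, k]" "[k] = replicate j 1" by auto
  thus "p \<in> {[n - 1, 1]}" by (cases j) auto
next
  fix p assume p: "p \<in> {[n - 1, 1]}"
  have "[n - 1, 1] \<in> left_edge n"
    using assms by (force simp: left_edge_def)
  moreover have "[n - 1, 1] = (n - 1) # replicate 1 1" by simp
  hence "[n - 1, 1] \<in> main_chain n"
    using assms unfolding main_chain_def by fastforce
  ultimately show "p \<in> left_edge n \<inter> main_chain n" using p by simp
qed

lemma right_edge_eq: "right_edge n = {two_columns n k | k. 1 \<le> k \<and> k \<le> n div 2}"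
  by (force simp: right_edge_def left_edge_def conjugate_two_rows)

lemma right_edge_Int_main_chain:
  assumes "n \<ge> 2"
  shows "right_edge n \<inter> main_chain n = {2 # replicate (n - 2) 1}"
proof (intro equalityI subsetI)
  fix p assume "p \<in> right_edge n \<inter> main_chain n"
  then obtain k j where k: "1 \<le> k" "p = two_columns n k" and j: "p = (n - j) # replicate j 1"
    unfolding right_edge_eq main_chain_def by blast
  obtain l where l: "k = Suc l" using k by (cases k) auto
  have "replicate l 2 @ replicate (n - 2 * k) 1 = replicate j (1::nat)"
    using k j by (simp add: l)
  hence "set (replicate l 2) \<subseteq> set (replicate j (1::nat))"
    by (metis set_append Un_upper1)
  hence "l = 0" by (auto split: if_splits)
  thus "p \<in> {2 # replicate (n - 2) 1}" using k l by simp
next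
  fix p assume p: "p \<in> {2 # replicate (n - 2) (1::nat)}"
  have "two_columns n 1 \<in> right_edge n"
    unfolding right_edge_eq using assms by fastforce
  hence "2 # replicate (n - 2) 1 \<in> right_edge n" by simp
  moreover have "2 # replicate (n - 2) 1 = (n - (n - 2)) # replicate (n - 2) 1"
    using assms by simp
  hence "2 # replicate (n - 2) 1 \<in> main_chain n"
    unfolding main_chain_def using assms by (intro CollectI exI[of _ "n - 2"]) simp
  ultimately show "p \<in> right_edge n \<inter> main_chain n" using p by simp
qed

section \<open>The left and right edges\<close>

theorem proposition2p7:
  fixes n :: nat
  assumes "n \<ge> 2"
  shows "set (left_path n) = left_edge n \<and> vpath (left_path n) (with_proj (partition_graph n)) \<and>
    set (right_path n) = right_edge n \<and> vpath (right_path n) (with_proj (partition_graph n)) \<and>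
    (\<forall>k. 1 \<le> k \<and> k < n div 2 \<longrightarrow>
       [n - k, k] \<rightarrow>\<^bsub>with_proj (partition_graph n)\<^esub> [n - k - 1, k + 1] \<and>
       conjugate [n - k, k] \<rightarrow>\<^bsub>with_proj (partition_graph n)\<^esub> conjugate [n - k - 1, k + 1]) \<and>
    left_edge n \<inter> main_chain n = {[n - 1, 1]} \<and>
    right_edge n \<inter> main_chain n = {2 # replicate (n - 2) 1}"
proof -
  let ?G = "with_proj (partition_graph n)"
  have verts: "verts ?G = partitions n" by (simp add: partition_graph_def)
  have nonempty: "1 < Suc (n div 2)" using assms by simp
  have left: "set (left_path n) = left_edge n"
    by (auto simp: left_path_def left_edge_def)
  hence right: "set (right_path n) = right_edge n"
    by (simp add: right_path_def right_edge_def)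
  have adj_left: "[n - k, k] \<rightarrow>\<^bsub>?G\<^esub> [n - Suc k, Suc k]" if "1 \<le> k" "Suc k < Suc (n div 2)" for k
    using two_rows_adjacent[of k n] that by simp
  have adj_right: "conjugate [n - k, k] \<rightarrow>\<^bsub>?G\<^esub> conjugate [n - Suc k, Suc k]"
    if "Suc k < Suc (n div 2)" for k
    using two_columns_adjacent[of k n] that
      conjugate_two_rows[of k n] conjugate_two_rows[of "Suc k" n] by simp
  have left_vpath: "vpath (left_path n) ?G"
    unfolding left_path_def
  proof (rule vpath_map_upt[OF nonempty])
    show "[n - k, k] \<rightarrow>\<^bsub>?G\<^esub> [n - Suc k, Suc k]" if "1 \<le> k" "Suc k < Suc (n div 2)" for k
      using adj_left that .
    show "[n - k, k] \<in> verts ?G" if "1 \<le> k" "k < Suc (n div 2)" for k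
      unfolding verts using two_rows_partition that by simp
    show "inj_on (\<lambda>k. [n - k, k]) {1..<Suc (n div 2)}" by (simp add: inj_on_def)
  qed
  have right_eq: "right_path n = map (\<lambda>k. conjugate [n - k, k]) [1..<Suc (n div 2)]"
    by (simp add: right_path_def left_path_def)
  have right_vpath: "vpath (right_path n) ?G"
    unfolding right_eq
  proof (rule vpath_map_upt[OF nonempty])
    show "conjugate [n - k, k] \<rightarrow>\<^bsub>?G\<^esub> conjugate [n - Suc k, Suc k]"
      if "Suc k < Suc (n div 2)" for k
      using adj_right that .
    show "conjugate [n - k, k] \<in> verts ?G" if "1 \<le> k" "k < Suc (n div 2)" for k
      unfolding verts using conjugate_partition two_rows_partition that by simp
    show "inj_on (\<lambda>k. conjugate [n - k, k]) {1..<Suc (n div 2)}"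
    proof (rule inj_onI)
      fix k l
      assume kl: "k \<in> {1..<Suc (n div 2)}" "l \<in> {1..<Suc (n div 2)}"
        and eq: "conjugate [n - k, k] = conjugate [n - l, l]"
      have "length (two_columns n k) = length (two_columns n l)"
        using eq kl conjugate_two_rows[of k n] conjugate_two_rows[of l n] by simp
      thus "k = l" using kl by auto
    qed
  qed
  show ?thesis
    using left right left_vpath right_vpath adj_left adj_right
      left_edge_Int_main_chain[OF assms] right_edge_Int_main_chain[OF assms]
    by simp
qed

end
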